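(* Let $K\ge 1$ be the number of nodes, $N$ the total number of datapoints (with $N/K$ a positive integer), and let $f:\mathbb{R}^d\to\mathbb{R}$ be $f(w)=\frac1K\sum_{k=1}^K f_k(w)$ with $f_k(w)=\frac{K}{N}\sum_{j=1}^{N/K} f_{k,j}(w)$. Assume that for each $k\in\{1,\dots,K\}$ $$\frac{K}{N}\sum_{j=1}^{N/K} f_{k,j}(w)=\frac12 (w-w_k^* )^\top H_k (w-w_k^* )\qquad\text{for all } w\in\mathbb{R}^d,$$ where $w_k^*\in\mathbb{R}^d$ and $H_k\in\mathbb{R}^{d\times d}$ is (symmetric) positive definite. Consider the dSAGA iterates with every inner loop run to convergence, i.e. vectors $w_k^{t,0}$, $w_k^{t,\infty}\in\mathbb{R}^d$ ($1\le k\le K$, integers $t\ge 0$), started from arbitrary vectors $w_1^{-1,\infty},\dots,w_K^{-1,\infty}\in\mathbb{R}^d$, such that for every $t\ge 0$ and every $k$ $$w_k^{t,0}=w^{t,0}:=\frac1K\sum_{l=1}^K w_l^{t-1,\infty},\qquad \nabla f_k(w_k^{t,\infty})=\nabla f_k(w_k^{t,0})-\frac1K\sum_{l=1}^K \nabla f_l(w_l^{t-1,\infty}).$$ Let $w^*$ be the global minimiser of $f$. If $\max_{k,l}\|I-H_k^{-1}H_l\|\le\rho<1$, then there is a constant $C_0$, depending on the starting point but not on $t$, such that for each $l\in\{1,\dots,K\}$ and each $t\ge 0$ $$\|w_l^{t,0}-w^*\|\le\left(1-\frac1K\right)^t\rho^t\, C_0 .$$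
   Context: $\|\cdot\|$ denotes the Euclidean norm on vectors and the induced operator norm on matrices; $I$ is the identity matrix; the convention $0^0=1$ is used. dSAGA (distributed SAGA) is an algorithm in which $K$ nodes each hold $N/K$ of the loss functions $f_{k,j}$. Between the synchronisations indexed by $t$, node $k$ runs an inner SAGA-type loop starting at $w_k^{t,0}$, using its own stored gradients plus the correction term $-\nabla f_k(w_k^{t,0})+\frac1K\sum_l\nabla f_l(w_l^{t-1,\infty})$ received and computed at the synchronisation. The limit of the inner loop on node $k$ is denoted $w_k^{t,\infty}$. Inner loops are assumed to be run to convergence, so $w_k^{t,\infty}$ is the point characterised by $\nabla f_k(w_k^{t,\infty})-\nabla f_k(w_k^{t,0})+\frac1K\sum_l\nabla f_l(w_l^{t-1,\infty})=0$, and at each synchronisation all nodes restart from the average of the limits of the preceding inner loops. *)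

theory Defs
  imports "HOL-Analysis.Analysis"
begin

definition gradient :: "('a::real_inner \<Rightarrow> real) \<Rightarrow> 'a \<Rightarrow> 'a" where
  "gradient f x = (THE D. GDERIV f x :> D)"

lemma gradient_eqI:
  assumes "GDERIV f x :> D"
  shows "gradient f x = D"
  unfolding gradient_def
proof (rule the_equality[where P = "\<lambda>D. GDERIV f x :> D", OF assms])
  fix D' assume "GDERIV f x :> D'"
  then have "(\<lambda>h. inner h D') = (\<lambda>h. inner h D)"
    using assms unfolding gderiv_def by (rule has_derivative_unique)
  then have "\<forall>h. inner h D' = inner h D"
    by (simp add: fun_eq_iff)
  then show "D' = D"
    by (simp only: vector_eq_ldot)
qed

definition sym_pos_def :: "real ^ 'n ^ 'n \<Rightarrow> bool" where
  "sym_pos_def A \<longleftrightarrow> transpose A = A \<and> (\<forall>x. x \<noteq> 0 \<longrightarrow> x \<bullet> (A *v x) > 0)"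

definition node_loss :: "nat \<Rightarrow> nat \<Rightarrow> (nat \<Rightarrow> nat \<Rightarrow> 'a \<Rightarrow> real) \<Rightarrow> nat \<Rightarrow> 'a \<Rightarrow> real" where
  "node_loss K N F k w = real K / real N * (\<Sum>j = 1..N div K. F k j w)"

definition global_loss :: "nat \<Rightarrow> nat \<Rightarrow> (nat \<Rightarrow> nat \<Rightarrow> 'a \<Rightarrow> real) \<Rightarrow> 'a \<Rightarrow> real" where
  "global_loss K N F w = 1 / real K * (\<Sum>k = 1..K. node_loss K N F k w)"

(* w0 t k is the point where the inner loop of node k starts after synchronisation t, and
   winf t k is the limit of that loop.  The index of winf is an integer because the first
   synchronisation (t = 0) uses the given vectors winf (-1) k = start k. *)
definition dsaga_iterates ::
  "nat \<Rightarrow> (nat \<Rightarrow> 'a::real_inner \<Rightarrow> real) \<Rightarrow> (nat \<Rightarrow> 'a) \<Rightarrow> (nat \<Rightarrow> nat \<Rightarrow> 'a) \<Rightarrow> (int \<Rightarrow> nat \<Rightarrow> 'a) \<Rightarrow> bool"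
where
  "dsaga_iterates K f start w0 winf \<longleftrightarrow>
     (\<forall>k\<in>{1..K}. winf (-1) k = start k) \<and>
     (\<forall>t. \<forall>k\<in>{1..K}.
        w0 t k = (1 / real K) *\<^sub>R (\<Sum>l = 1..K. winf (int t - 1) l) \<and>
        gradient (f k) (winf (int t) k) =
          gradient (f k) (w0 t k)
          - (1 / real K) *\<^sub>R (\<Sum>l = 1..K. gradient (f l) (winf (int t - 1) l)))"

end

theory Submission
  imports Defs
begin

text \<open>
  Write \<open>e t\<close> for the error \<open>w\<^sup>t\<^sup>,\<^sup>0 - w\<^sup>*\<close>, \<open>G t\<close> for the average of the gradients stored at the
  synchronisation \<open>t\<close>, and \<open>P\<close>, \<open>M\<close> for the averages of the matrices \<open>H k\<close> and of their inverses.
  The gradients are affine, so the iteration is the linear system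
  \<open>e (t + 1) = e t - M (G t)\<close>, \<open>G (t + 1) = P (e t) - G t\<close>.

  A single step need not contract, because \<open>G t\<close> is an average of gradients taken at different
  points and differs from \<open>P (e t)\<close>. Over two steps, however, \<open>G\<close> cancels:
  \<open>e (t + 2) = (I - M P) (e t)\<close>. Averaging the hypothesis over the pairs \<open>(k, l)\<close>
  bounds \<open>I - M P\<close> only by \<open>(1 - 1/K) \<rho>\<close>, which gives the square root of the claimed rate.
  The missing factor comes from symmetry: with \<open>Q = H\<^sub>k\<inverse> H\<^sub>l\<close>, the pairs \<open>(k, l)\<close> and \<open>(l, k)\<close>
  together contribute \<open>(I - Q) + (I - Q\<inverse>) = (I - Q) (I - Q\<inverse>)\<close>, of norm at most \<open>\<rho>\<^sup>2\<close>.
  Hence \<open>I - M P\<close> has norm at most \<open>(1 - 1/K) \<rho>\<^sup>2 / 2\<close>, and this is at most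
  \<open>((1 - 1/K) \<rho>)\<^sup>2\<close>, because \<open>1/2 \<le> 1 - 1/K\<close> for \<open>K \<ge> 2\<close>, while both vanish for \<open>K = 1\<close>.

  The even errors are now controlled by \<open>e 0\<close> and the odd ones by \<open>e 1\<close>. The constant absorbs
  \<open>e 1\<close> after division by the rate, except when the rate is \<open>0\<close>; in that case all \<open>H k\<close> coincide,
  and \<open>e 1 = 0\<close>.
\<close>

section \<open>Averages of invertible maps and of their inverses\<close>

text \<open>
  The pairing that turns a first-order deviation into a second-order one: for \<open>Q = B k \<circ> A l\<close>,
  with inverse \<open>B l \<circ> A k\<close>, one has \<open>2 I - Q - Q\<inverse> = (I - Q) (I - Q\<inverse>)\<close>.
\<close>

lemma sum_deviation_products:
  fixes A B :: "'i \<Rightarrow> 'a::real_vector \<Rightarrow> 'a"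
  assumes lin: "\<And>k. k \<in> I \<Longrightarrow> linear (A k)" "\<And>k. k \<in> I \<Longrightarrow> linear (B k)"
    and inv: "\<And>k x. k \<in> I \<Longrightarrow> A k (B k x) = x" "\<And>k x. k \<in> I \<Longrightarrow> B k (A k x) = x"
  shows "(\<Sum>k\<in>I. \<Sum>l\<in>I. (x - B l (A k x)) - B k (A l (x - B l (A k x))))
    = (2 * (real (card I))\<^sup>2) *\<^sub>R x - 2 *\<^sub>R (\<Sum>k\<in>I. B k (\<Sum>l\<in>I. A l x))"
proof -
  have "(x - B l (A k x)) - B k (A l (x - B l (A k x))) = 2 *\<^sub>R x - B l (A k x) - B k (A l x)"
    if "k \<in> I" "l \<in> I" for k l
    using that by (simp add: linear_diff lin inv scaleR_2)
  then have "(\<Sum>k\<in>I. \<Sum>l\<in>I. (x - B l (A k x)) - B k (A l (x - B l (A k x))))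
      = (\<Sum>k\<in>I. \<Sum>l\<in>I. 2 *\<^sub>R x - B l (A k x) - B k (A l x))"
    by (intro sum.cong refl) auto
  also have "\<dots> = (2 * (real (card I))\<^sup>2) *\<^sub>R x
      - (\<Sum>k\<in>I. \<Sum>l\<in>I. B l (A k x)) - (\<Sum>k\<in>I. \<Sum>l\<in>I. B k (A l x))"
    by (simp add: sum_subtractf sum_constant_scaleR power2_eq_square mult_ac del: sum_constant)
  also have "(\<Sum>k\<in>I. \<Sum>l\<in>I. B l (A k x)) = (\<Sum>k\<in>I. \<Sum>l\<in>I. B k (A l x))"
    by (rule sum.swap)
  also have "(\<Sum>k\<in>I. \<Sum>l\<in>I. B k (A l x)) = (\<Sum>k\<in>I. B k (\<Sum>l\<in>I. A l x))"
    by (intro sum.cong refl) (simp add: linear_sum lin)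
  finally show ?thesis
    by (simp add: scaleR_2 algebra_simps)
qed

text \<open>
  In the pairing identity only the off-diagonal pairs contribute. The factor \<open>1/2\<close> that it brings
  is what makes \<open>(1 - 1/K)\<^sup>2\<close>, and not only \<open>1 - 1/K\<close>, attainable.
\<close>

lemma average_inverse_contraction:
  fixes A B :: "nat \<Rightarrow> 'a::real_normed_vector \<Rightarrow> 'a"
  assumes K: "K \<ge> 1"
    and lin: "\<And>k. k \<in> {1..K} \<Longrightarrow> linear (A k)" "\<And>k. k \<in> {1..K} \<Longrightarrow> linear (B k)"
    and inv: "\<And>k x. k \<in> {1..K} \<Longrightarrow> A k (B k x) = x" "\<And>k x. k \<in> {1..K} \<Longrightarrow> B k (A k x) = x"
    and dev: "\<And>k l x. k \<in> {1..K} \<Longrightarrow> l \<in> {1..K} \<Longrightarrow> norm (x - B k (A l x)) \<le> \<rho> * norm x"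
    and "\<rho> \<ge> 0"
  shows "norm (x - (1 / real K) *\<^sub>R (\<Sum>k = 1..K. B k ((1 / real K) *\<^sub>R (\<Sum>l = 1..K. A l x))))
    \<le> ((1 - 1 / real K) * \<rho>)\<^sup>2 * norm x"
    (is "norm ?y \<le> _")
proof -
  let ?D = "\<lambda>k l. (x - B l (A k x)) - B k (A l (x - B l (A k x)))"
  have D: "norm (?D k l) \<le> (if k = l then 0 else \<rho>\<^sup>2 * norm x)"
    if "k \<in> {1..K}" "l \<in> {1..K}" for k l
  proof (cases "k = l")
    case True
    then show ?thesis
      using that by (simp add: inv linear_0 lin)
  next
    case False
    have "norm (?D k l) \<le> \<rho> * norm (x - B l (A k x))"
      by (rule dev) (use that in auto)
    also have "\<dots> \<le> \<rho> * (\<rho> * norm x)"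
      by (intro mult_left_mono dev \<open>\<rho> \<ge> 0\<close>) (use that in auto)
    finally show ?thesis
      using False by (simp add: power2_eq_square)
  qed
  have "(2 * (real K)\<^sup>2) *\<^sub>R ?y = (\<Sum>k = 1..K. \<Sum>l = 1..K. ?D k l)"
  proof -
    have "(\<Sum>k = 1..K. B k ((1 / real K) *\<^sub>R (\<Sum>l = 1..K. A l x)))
        = (1 / real K) *\<^sub>R (\<Sum>k = 1..K. B k (\<Sum>l = 1..K. A l x))"
      unfolding scaleR_sum_right[of "1 / real K" "\<lambda>k. B k (\<Sum>l = 1..K. A l x)"]
      by (rule sum.cong[OF refl]) (rule linear_scale[OF lin(2)])
    moreover have "(\<Sum>k = 1..K. \<Sum>l = 1..K. ?D k l)
        = (2 * (real K)\<^sup>2) *\<^sub>R x - 2 *\<^sub>R (\<Sum>k = 1..K. B k (\<Sum>l = 1..K. A l x))"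
      using sum_deviation_products[of "{1..K}" A B x] lin inv by simp
    ultimately show ?thesis
      using K by (simp add: scaleR_diff_right power2_eq_square)
  qed
  moreover have "norm ((2 * (real K)\<^sup>2) *\<^sub>R z) = 2 * (real K)\<^sup>2 * norm z" for z :: 'a
    by simp
  ultimately have "2 * (real K)\<^sup>2 * norm ?y = norm (\<Sum>k = 1..K. \<Sum>l = 1..K. ?D k l)"
    by metis
  also have "\<dots> \<le> (\<Sum>k = 1..K. \<Sum>l = 1..K. norm (?D k l))"
    by (intro order_trans[OF norm_sum] sum_mono norm_sum)
  also have "\<dots> \<le> (\<Sum>k = 1..K. \<Sum>l = 1..K. if k = l then 0 else \<rho>\<^sup>2 * norm x)"
    by (intro sum_mono D)
  also have "\<dots> = (\<Sum>k = 1..K. \<Sum>l = 1..K. \<rho>\<^sup>2 * norm x - (if k = l then \<rho>\<^sup>2 * norm x else 0))"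
    by (intro sum.cong refl) auto
  also have "\<dots> = real K * (real K - 1) * (\<rho>\<^sup>2 * norm x)"
    by (simp add: sum_subtractf algebra_simps)
  also have "\<dots> \<le> 2 * (real K - 1)\<^sup>2 * (\<rho>\<^sup>2 * norm x)"
  proof (rule mult_right_mono)
    have "0 \<le> (real K - 1) * (real K - 2)"
    proof (cases "K = 1")
      case False
      then show ?thesis using K by simp
    qed simp
    then show "real K * (real K - 1) \<le> 2 * (real K - 1)\<^sup>2"
      by (simp add: power2_eq_square algebra_simps)
  qed simp
  also have "\<dots> = 2 * (real K)\<^sup>2 * (((1 - 1 / real K) * \<rho>)\<^sup>2 * norm x)"
    using K by (simp add: field_simps power2_eq_square)
  finally show ?thesis
    using K by simp
qed

text \<open>
  The variable \<open>g\<close> drops out because the block matrix of the system, with rows \<open>(I, -M)\<close> and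
  \<open>(P, -I)\<close>, has a block diagonal square.
\<close>

lemma two_step_elimination:
  fixes e g :: "nat \<Rightarrow> 'a::real_vector"
  assumes "linear M"
    and "\<And>t. e (Suc t) = e t - M (g t)" and "\<And>t. g (Suc t) = P (e t) - g t"
  shows "e (Suc (Suc t)) = e t - M (P (e t))"
  by (simp add: assms linear_diff[OF assms(1)])

text \<open>
  A bound on two steps by \<open>c\<^sup>2\<close> yields the rate \<open>c\<close>. For \<open>c = 0\<close> the second summand of the constant
  is \<open>0\<close>, hence the condition on \<open>e 1\<close>.
\<close>

lemma two_step_geometric_bound:
  fixes e :: "nat \<Rightarrow> 'a::real_normed_vector"
  assumes "c \<ge> 0" and step: "\<And>t. norm (e (Suc (Suc t))) \<le> c\<^sup>2 * norm (e t)"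
    and zero: "c = 0 \<Longrightarrow> e 1 = 0"
  shows "norm (e t) \<le> c ^ t * (norm (e 0) + norm (e 1) / c)"
proof (induction t rule: induct_nat_012)
  case 0
  then show ?case using \<open>c \<ge> 0\<close> by simp
next
  case 1
  then show ?case using \<open>c \<ge> 0\<close> zero by (cases "c = 0") (auto simp: field_simps)
next
  case (ge2 t)
  have "norm (e (Suc (Suc t))) \<le> c\<^sup>2 * norm (e t)"
    by (rule step)
  also have "\<dots> \<le> c\<^sup>2 * (c ^ t * (norm (e 0) + norm (e 1) / c))"
    by (intro mult_left_mono ge2) simp
  finally show ?case
    by (simp add: power2_eq_square)
qed

section \<open>Quadratic losses\<close>

lemma GDERIV_quadratic:
  fixes A :: "real ^ 'n ^ 'n"
  assumes "transpose A = A"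
  shows "GDERIV (\<lambda>w. 1/2 * ((w - a) \<bullet> (A *v (w - a)))) w :> A *v (w - a)"
proof -
  have sym: "(w - a) \<bullet> (A *v h) = h \<bullet> (A *v (w - a))" for h
  proof -
    have "(w - a) \<bullet> (A *v h) = (transpose A *v (w - a)) \<bullet> h"
      by (simp add: dot_lmul_matrix)
    then show ?thesis
      by (simp only: assms inner_commute)
  qed
  have shift: "((\<lambda>w. w - a) has_derivative (\<lambda>h. h)) (at w)"
    by (rule has_derivative_eq_rhs, (rule derivative_intros)+) simp
  then have "((\<lambda>w. A *v (w - a)) has_derivative (\<lambda>h. A *v h)) (at w)"
    by (rule bounded_linear.has_derivative[OF matrix_vector_mul_bounded_linear])
  from has_derivative_mult_right[OF has_derivative_inner[OF shift this], of "1/2"]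
  show ?thesis
    unfolding gderiv_def by (simp add: sym)
qed

lemma sym_pos_def_invertible:
  assumes "sym_pos_def A"
  shows "invertible A"
proof -
  have "x = 0" if "A *v x = 0" for x
    using assms that unfolding sym_pos_def_def by (metis inner_zero_right less_irrefl)
  then show ?thesis
    unfolding invertible_left_inverse matrix_left_invertible_ker by blast
qed

lemma arg_min_quadratic_average:
  fixes H :: "nat \<Rightarrow> real ^ 'd ^ 'd"
  assumes "K \<ge> 1" and "\<And>k. k \<in> {1..K} \<Longrightarrow> transpose (H k) = H k"
    and f: "\<And>k w. k \<in> {1..K} \<Longrightarrow> f k w = 1/2 * ((w - a k) \<bullet> (H k *v (w - a k)))"
    and min: "is_arg_min (\<lambda>w. 1 / real K * (\<Sum>k = 1..K. f k w)) (\<lambda>w. True) x"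
  shows "(\<Sum>k = 1..K. H k *v (x - a k)) = 0"
proof -
  let ?f = "\<lambda>w. 1 / real K * (\<Sum>k = 1..K. f k w)"
  let ?g = "\<Sum>k = 1..K. H k *v (x - a k)"
  have "(f k has_derivative (\<lambda>h. h \<bullet> (H k *v (x - a k)))) (at x)" if "k \<in> {1..K}" for k
  proof -
    have "f k = (\<lambda>w. 1/2 * ((w - a k) \<bullet> (H k *v (w - a k))))"
      using f that by auto
    then show ?thesis
      using GDERIV_quadratic[OF assms(2)[OF that], of "a k" x] by (simp add: gderiv_def)
  qed
  then have deriv: "(?f has_derivative (\<lambda>h. 1 / real K * (h \<bullet> ?g))) (at x)"
    unfolding inner_sum_right by (intro has_derivative_mult_right has_derivative_sum) auto
  have "\<forall>y. ?f x \<le> ?f y"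
    using min unfolding is_arg_min_def by (meson not_le)
  then have "(\<lambda>h. 1 / real K * (h \<bullet> ?g)) = (\<lambda>h. 0)"
    using differential_zero_maxmin[OF _ open_UNIV deriv] by blast
  then have "1 / real K * (?g \<bullet> ?g) = 0"
    by (rule fun_cong)
  then show ?thesis
    using assms(1) by simp
qed

section \<open>Convergence of dSAGA on quadratic losses\<close>

theorem lemma1:
  fixes K N :: nat
    and F :: "nat \<Rightarrow> nat \<Rightarrow> real ^ 'd \<Rightarrow> real"
    and H :: "nat \<Rightarrow> real ^ 'd ^ 'd"
    and wstar_loc :: "nat \<Rightarrow> real ^ 'd"
    and wstar :: "real ^ 'd"
    and \<rho> :: real
    and start :: "nat \<Rightarrow> real ^ 'd"
  assumes "K \<ge> 1" and "N > 0" and "K dvd N"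
    and "\<And>k. k \<in> {1..K} \<Longrightarrow> sym_pos_def (H k)"
    and "\<And>k w. k \<in> {1..K} \<Longrightarrow>
           node_loss K N F k w = 1/2 * ((w - wstar_loc k) \<bullet> (H k *v (w - wstar_loc k)))"
    and "is_arg_min (global_loss K N F) (\<lambda>w. True) wstar"
    and "(MAX (k, l) \<in> {1..K} \<times> {1..K}. onorm ((*v) (mat 1 - matrix_inv (H k) ** H l))) \<le> \<rho>"
    and "\<rho> < 1"
  shows "\<exists>C0. \<forall>w0 winf. dsaga_iterates K (node_loss K N F) start w0 winf \<longrightarrow>
           (\<forall>l\<in>{1..K}. \<forall>t. norm (w0 t l - wstar) \<le> (1 - 1 / real K) ^ t * \<rho> ^ t * C0)"
proof -
  note K = \<open>K \<ge> 1\<close>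
  define A where "A k x = H k *v x" for k x
  define B where "B k x = matrix_inv (H k) *v x" for k x
  define grad where "grad k w = A k (w - wstar_loc k)" for k w
  define P where "P x = (1 / real K) *\<^sub>R (\<Sum>l = 1..K. A l x)" for x
  define M where "M x = (1 / real K) *\<^sub>R (\<Sum>k = 1..K. B k x)" for x
  define c where "c = (1 - 1 / real K) * \<rho>"

  have linA: "linear (A k)" and linB: "linear (B k)" for k
    unfolding A_def[abs_def] B_def[abs_def] by (rule matrix_vector_mul_linear)+
  have sym: "transpose (H k) = H k" if "k \<in> {1..K}" for k
    using assms(4)[OF that] unfolding sym_pos_def_def by simp
  have inv: "A k (B k x) = x" "B k (A k x) = x" if "k \<in> {1..K}" for k x
  proof -
    have "H k ** matrix_inv (H k) = mat 1 \<and> matrix_inv (H k) ** H k = mat 1"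
      using someI_ex[OF sym_pos_def_invertible[OF assms(4)[OF that], unfolded invertible_def]]
      unfolding matrix_inv_def .
    then show "A k (B k x) = x" "B k (A k x) = x"
      unfolding A_def B_def by (simp_all add: matrix_vector_mul_assoc)
  qed
  have linM: "linear M"
    unfolding M_def[abs_def] by (intro linear_compose_scale_right linear_compose_sum) (auto intro: linB)

  have onorm_dev: "onorm ((*v) (mat 1 - matrix_inv (H k) ** H l)) \<le> \<rho>"
    if "k \<in> {1..K}" "l \<in> {1..K}" for k l
  proof -
    have "onorm ((*v) (mat 1 - matrix_inv (H k) ** H l))
        \<le> (MAX (k, l) \<in> {1..K} \<times> {1..K}. onorm ((*v) (mat 1 - matrix_inv (H k) ** H l)))"
      by (rule Max_ge) (use that in force)+
    then show ?thesis
      using assms(7) by linarith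
  qed
  have dev: "norm (x - B k (A l x)) \<le> \<rho> * norm x" if "k \<in> {1..K}" "l \<in> {1..K}" for k l x
  proof -
    have "x - B k (A l x) = (mat 1 - matrix_inv (H k) ** H l) *v x"
      unfolding A_def B_def by (simp add: matrix_vector_mult_diff_rdistrib matrix_vector_mul_assoc)
    also have "norm \<dots> \<le> onorm ((*v) (mat 1 - matrix_inv (H k) ** H l)) * norm x"
      by (rule onorm[OF matrix_vector_mul_bounded_linear])
    also have "\<dots> \<le> \<rho> * norm x"
      by (intro mult_right_mono onorm_dev that) simp
    finally show ?thesis .
  qed
  have "\<rho> \<ge> 0"
    using onorm_dev[of 1 1] onorm_pos_le[OF matrix_vector_mul_bounded_linear] K
    by (meson atLeastAtMost_iff order_refl order_trans)
  then have "c \<ge> 0"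
    using K by (simp add: c_def)

  have contraction: "norm (x - M (P x)) \<le> c\<^sup>2 * norm x" for x
    unfolding M_def P_def c_def
    by (rule average_inverse_contraction) (use K linA linB inv dev \<open>\<rho> \<ge> 0\<close> in auto)

  have gradient: "gradient (node_loss K N F k) w = grad k w" if "k \<in> {1..K}" for k w
  proof -
    have "node_loss K N F k = (\<lambda>w. 1/2 * ((w - wstar_loc k) \<bullet> (H k *v (w - wstar_loc k))))"
      using assms(5)[OF that] by auto
    then show ?thesis
      using gradient_eqI[OF GDERIV_quadratic[OF sym[OF that], of "wstar_loc k" w]]
      by (simp only: grad_def A_def)
  qed
  have optimal: "(\<Sum>k = 1..K. grad k wstar) = 0"
    unfolding grad_def A_def
  proof (rule arg_min_quadratic_average[OF K])
    show "is_arg_min (\<lambda>w. 1 / real K * (\<Sum>k = 1..K. node_loss K N F k w)) (\<lambda>w. True) wstar"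
      using assms(6) unfolding global_loss_def[abs_def] .
  qed (fact sym assms(5))+
  have grad_diff: "grad k x = A k (x - y) + grad k y" for k x y
    unfolding grad_def by (simp add: linear_diff[OF linA])
  have mean_grad: "(1 / real K) *\<^sub>R (\<Sum>k = 1..K. grad k x) = P (x - wstar)" for x
  proof -
    have "(\<Sum>k = 1..K. grad k x) = (\<Sum>k = 1..K. A k (x - wstar)) + (\<Sum>k = 1..K. grad k wstar)"
      unfolding sum.distrib[symmetric] using grad_diff by (intro sum.cong refl) blast
    then show ?thesis
      using optimal by (simp add: P_def)
  qed

  \<comment> \<open>\<open>C0\<close> is chosen before the iterates, so it is built from the first two errors,
    expressed through the starting vectors.\<close>
  define e0 where "e0 = (1 / real K) *\<^sub>R (\<Sum>l = 1..K. start l) - wstar"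
  define e1 where "e1 = e0 - M ((1 / real K) *\<^sub>R (\<Sum>l = 1..K. grad l (start l)))"

  \<comment> \<open>For coinciding \<open>A k\<close>, averaging the gradients agrees with averaging the points, so the
    first stored average is \<open>P e0\<close> and the two-step contraction applies to a single step.\<close>
  have e1_zero: "e1 = 0" if "c = 0"
  proof -
    have 1: "1 \<in> {1..K}"
      using K by simp
    have same: "A l x = A 1 x" if "l \<in> {1..K}" for l x
    proof (cases "K = 1")
      case False
      then have "\<rho> = 0"
        using \<open>c = 0\<close> K by (auto simp: c_def field_simps)
      then have "x = B 1 (A l x)"
        using dev[OF 1 that, of x] by simp
      then show ?thesis
        using inv(1)[OF 1] by metis
    qed (use that in auto)
    have grad1: "grad l (start l) = A 1 (start l - wstar) + grad l wstar" if "l \<in> {1..K}" for l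
      using grad_diff[of l "start l" wstar] same[OF that] by simp
    have "(\<Sum>l = 1..K. grad l (start l)) = (\<Sum>l = 1..K. A 1 (start l - wstar))"
      using optimal by (simp add: grad1 sum.distrib)
    also have "\<dots> = A 1 (\<Sum>l = 1..K. start l - wstar)"
      by (simp add: linear_sum[OF linA])
    also have "(\<Sum>l = 1..K. start l - wstar) = real K *\<^sub>R e0"
      using K by (simp add: e0_def sum_subtractf scaleR_diff_right sum_constant_scaleR del: sum_constant)
    finally have "(1 / real K) *\<^sub>R (\<Sum>l = 1..K. grad l (start l)) = A 1 e0"
      using K by (simp add: linear_scale[OF linA])
    also have "\<dots> = (1 / real K) *\<^sub>R (\<Sum>l = 1..K. A 1 e0)"
      using K by (simp add: sum_constant_scaleR del: sum_constant)
    also have "(\<Sum>l = 1..K. A 1 e0) = (\<Sum>l = 1..K. A l e0)"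
      by (intro sum.cong refl same[symmetric])
    also have "(1 / real K) *\<^sub>R \<dots> = P e0"
      by (simp only: P_def)
    finally have "e1 = e0 - M (P e0)"
      by (simp add: e1_def)
    then show ?thesis
      using contraction[of e0] that by simp
  qed

  show ?thesis
  proof (intro exI allI impI ballI)
    fix w0 :: "nat \<Rightarrow> nat \<Rightarrow> real ^ 'd" and winf :: "int \<Rightarrow> nat \<Rightarrow> real ^ 'd" and l t
    assume iter: "dsaga_iterates K (node_loss K N F) start w0 winf" and l: "l \<in> {1..K}"
    define e where "e t = (1 / real K) *\<^sub>R (\<Sum>l = 1..K. winf (int t - 1) l) - wstar" for t
    define G where "G t = (1 / real K) *\<^sub>R (\<Sum>l = 1..K. grad l (winf (int t - 1) l))" for t
    have w0: "w0 t k = e t + wstar" if "k \<in> {1..K}" for t k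
      using iter that unfolding dsaga_iterates_def e_def by simp
    have inner: "grad k (winf (int t) k) = grad k (e t + wstar) - G t" if k: "k \<in> {1..K}" for t k
    proof -
      have "gradient (node_loss K N F k) (winf (int t) k) = gradient (node_loss K N F k) (w0 t k)
          - (1 / real K) *\<^sub>R (\<Sum>l = 1..K. gradient (node_loss K N F l) (winf (int t - 1) l))"
        using iter k unfolding dsaga_iterates_def by blast
      then show ?thesis
        by (simp add: gradient gradient[OF k] w0[OF k] G_def)
    qed
    have winf: "winf (int t) k = e t + wstar - B k (G t)" if k: "k \<in> {1..K}" for t k
    proof -
      have "A k (winf (int t) k - (e t + wstar)) = - G t"
        using inner[OF k, of t] grad_diff[of k "winf (int t) k" "e t + wstar"] by simp
      then have "winf (int t) k - (e t + wstar) = B k (- G t)"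
        using inv(2)[OF k] by metis
      then show ?thesis
        by (simp add: linear_neg[OF linB] algebra_simps)
    qed
    have e_Suc: "e (Suc t) = e t - M (G t)" for t
      using K by (simp add: e_def[of "Suc t"] winf M_def sum_subtractf sum.distrib
          scaleR_diff_right scaleR_add_right sum_constant_scaleR del: sum_constant)
    have G_Suc: "G (Suc t) = P (e t) - G t" for t
    proof -
      have "G (Suc t) = (1 / real K) *\<^sub>R (\<Sum>k = 1..K. grad k (e t + wstar)) - G t"
        using K by (simp add: G_def[of "Suc t"] inner sum_subtractf scaleR_diff_right
            sum_constant_scaleR del: sum_constant)
      then show ?thesis
        using mean_grad[of "e t + wstar"] by simp
    qed
    have "winf (-1) k = start k" if "k \<in> {1..K}" for k
      using iter that unfolding dsaga_iterates_def by blast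
    then have "e 0 = e0" "G 0 = (1 / real K) *\<^sub>R (\<Sum>l = 1..K. grad l (start l))"
      by (simp_all add: e_def e0_def G_def)
    moreover from this have "e 1 = e1"
      using e_Suc[of 0] by (simp add: e1_def)
    moreover have "norm (e t) \<le> c ^ t * (norm (e 0) + norm (e 1) / c)"
    proof (rule two_step_geometric_bound[OF \<open>c \<ge> 0\<close>])
      show "norm (e (Suc (Suc t))) \<le> c\<^sup>2 * norm (e t)" for t
        unfolding two_step_elimination[of M e G P, OF linM e_Suc G_Suc] by (rule contraction)
      show "e 1 = 0" if "c = 0"
        using e1_zero[OF that] \<open>e 1 = e1\<close> by simp
    qed
    ultimately show "norm (w0 t l - wstar)
        \<le> (1 - 1 / real K) ^ t * \<rho> ^ t * (norm e0 + norm e1 / c)"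
      using w0[OF l] by (simp add: c_def power_mult_distrib)
  qed
qed

end
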